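(* Let $\mu$ be a $T$-invariant probability measure on a space $\Omega$, where $T:\Omega\to\Omega$ is measurable, and let $U_n\subset\Omega$ be a nested (decreasing) sequence of measurable sets of positive measure with $\mu(U_n)\to0$ as $n\to\infty$. Assume that the limits $\hat\alpha_\ell(L)=\lim_{n\to\infty}\hat\alpha_\ell(L,U_n)$ exist for $\ell=1,2,\dots$ and all $L$ large enough, and put $\hat\alpha_\ell=\lim_{L\to\infty}\hat\alpha_\ell(L)$. Assume $\sum_{\ell=1}^\infty\ell\hat\alpha_\ell<\infty$. Then for every $k=1,2,\dots$ $$\lambda_k=\frac{\alpha_k-\alpha_{k+1}}{\alpha_1},$$ where $\alpha_k=\hat\alpha_k-\hat\alpha_{k+1}$. In particular the limit defining $\lambda_k$ exists.
   Context: For $U\subset\Omega$ with $\mu(U)>0$, $\mu_U$ is the normalised restriction of $\mu$ to $U$ and $\mathbb{P}=\mu$. The first entry/return time is $\tau_U(x)=\min\{j\ge1:T^jx\in U\}$, higher order returns are $\tau_U^1=\tau_U$, $\tau_U^\ell(x)=\tau_U^{\ell-1}(x)+\tau_U(T^{\tau_U^{\ell-1}(x)}x)$, and $\tau_U^0=0$ on $U$. Put $$\hat\alpha_\ell(L,U)=\mu_U(\tau_U^{\ell-1}\le L).$$ The limit $\hat\alpha_\ell=\lim_{L\to\infty}\hat\alpha_\ell(L)$ exists by monotonicity in $L$. Let $Z_U^L=\sum_{i=0}^{2L}\mathbf{1}_U\circ T^i$ and $$\lambda_k(L,U)=\frac{\mathbb{P}(Z_U^L=k)}{\mathbb{P}(Z_U^L>0)},\qquad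 \lambda_k(L)=\lim_{n\to\infty}\lambda_k(L,U_n),\qquad \lambda_k=\lim_{L\to\infty}\lambda_k(L).$$
   Formalization: The limits λ_k(L) need not exist if the α̂_ℓ(L) converge only for large L; the formula for λ_k is proved assuming λ_k(L) exists for large L, which holds if all α̂_ℓ(L) converge; in general limsup and liminf over n of λ_k(L,U_n) tend to the stated value. *)

theory Defs
  imports "HOL-Probability.Probability"
begin

text \<open>Return times take values in \<^typ>\<open>enat\<close>; a point that never enters \<open>U\<close> has
  return time \<open>\<infinity>\<close>, being the infimum of the empty set.\<close>

definition return_time :: "('a \<Rightarrow> 'a) \<Rightarrow> 'a set \<Rightarrow> 'a \<Rightarrow> enat" where
  "return_time T U x = (INF j \<in> {j. 1 \<le> j \<and> (T ^^ j) x \<in> U}. enat j)"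

primrec nth_return_time :: "('a \<Rightarrow> 'a) \<Rightarrow> 'a set \<Rightarrow> nat \<Rightarrow> 'a \<Rightarrow> enat" where
  "nth_return_time T U 0 x = 0"
| "nth_return_time T U (Suc l) x =
     (case nth_return_time T U l x of
        enat m \<Rightarrow> enat m + return_time T U ((T ^^ m) x)
      | \<infinity> \<Rightarrow> \<infinity>)"

lemma nth_return_time_1: "nth_return_time T U (Suc 0) x = return_time T U x"
  by (simp add: zero_enat_def split: enat.split)

definition hat_alpha :: "'a measure \<Rightarrow> ('a \<Rightarrow> 'a) \<Rightarrow> nat \<Rightarrow> nat \<Rightarrow> 'a set \<Rightarrow> real" where
  "hat_alpha M T l L U =
     measure (uniform_measure M U) {x \<in> space M. nth_return_time T U (l - 1) x \<le> enat L}"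

text \<open>The constants below that are defined with \<^const>\<open>lim\<close> are meaningful only where the
  sequence in question converges.\<close>

definition hat_alpha_L :: "'a measure \<Rightarrow> ('a \<Rightarrow> 'a) \<Rightarrow> (nat \<Rightarrow> 'a set) \<Rightarrow> nat \<Rightarrow> nat \<Rightarrow> real" where
  "hat_alpha_L M T U l L = lim (\<lambda>n. hat_alpha M T l L (U n))"

definition hat_alpha_lim :: "'a measure \<Rightarrow> ('a \<Rightarrow> 'a) \<Rightarrow> (nat \<Rightarrow> 'a set) \<Rightarrow> nat \<Rightarrow> real" where
  "hat_alpha_lim M T U l = lim (\<lambda>L. hat_alpha_L M T U l L)"

definition alpha :: "'a measure \<Rightarrow> ('a \<Rightarrow> 'a) \<Rightarrow> (nat \<Rightarrow> 'a set) \<Rightarrow> nat \<Rightarrow> real" where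
  "alpha M T U k = hat_alpha_lim M T U k - hat_alpha_lim M T U (k + 1)"

definition visits :: "('a \<Rightarrow> 'a) \<Rightarrow> 'a set \<Rightarrow> nat \<Rightarrow> 'a \<Rightarrow> nat" where
  "visits T U L x = (\<Sum>i = 0..2 * L. indicator U ((T ^^ i) x))"

definition cluster_prob :: "'a measure \<Rightarrow> ('a \<Rightarrow> 'a) \<Rightarrow> nat \<Rightarrow> nat \<Rightarrow> 'a set \<Rightarrow> real" where
  "cluster_prob M T k L U =
     measure M {x \<in> space M. visits T U L x = k} / measure M {x \<in> space M. visits T U L x > 0}"

text \<open>For a given \<open>L\<close>, convergence of \<open>\<lambda>n. hat_alpha M T l j (U n)\<close> for all large
  \<open>j\<close> does not imply convergence of \<open>\<lambda>n. cluster_prob M T k L (U n)\<close>: the latter depends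
  on all time lags \<open>j \<le> 2 * L\<close>, including small ones. A counterexample is the doubling map
  with \<open>U n\<close> the union of \<open>(0, 2^(-n) * e n)\<close> and \<open>e n * P n\<close>, where
  \<open>P n = [1, 3/2) \<union> [2, 4)\<close> for odd \<open>n\<close>, \<open>P n = [1, 2) \<union> [4, 8)\<close> for even \<open>n\<close>, and
  \<open>e n\<close> tends to 0 sufficiently fast.\<close>

definition cluster_prob_L :: "'a measure \<Rightarrow> ('a \<Rightarrow> 'a) \<Rightarrow> (nat \<Rightarrow> 'a set) \<Rightarrow> nat \<Rightarrow> nat \<Rightarrow> real" where
  "cluster_prob_L M T U k L = lim (\<lambda>n. cluster_prob M T k L (U n))"

end

theory Submission
  imports Defs
begin

text \<open>Write \<open>Z\<close> for the number of visits to \<open>V\<close> during the window \<open>[0, 2L]\<close>, and let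
  \<open>\<alpha>\<^sub>k(j, V)\<close> be the probability under \<open>\<mu>\<^sub>V\<close> of exactly \<open>k - 1\<close> returns within time \<open>j\<close>. This
  equals the difference of the \<open>hat_alpha\<close> values at \<open>k\<close> and \<open>k + 1\<close>, because
  \<open>\<tau>\<^sup>l \<le> j\<close> says that there are at least \<open>l\<close> visits in times \<open>1, \<dots>, j\<close>.

  If \<open>Z \<ge> k \<ge> 1\<close>, there is a unique visit that is the \<open>k\<close>-th from the last. A visit \<open>j\<close> time
  units before the end of the window has this role if and only if exactly \<open>k - 1\<close> further visits
  occur in the remaining time \<open>j\<close>. By invariance of \<open>\<mu>\<close> this gives the exact identity
  \<open>\<mu>(Z \<ge> k) = \<mu>(V) * (\<Sum>j\<le>2L. \<alpha>\<^sub>k(j, V))\<close> (lemma \<open>prob_visits_ge\<close>), hence with the means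
  \<open>m\<^sub>k(L, V)\<close> of \<open>\<alpha>\<^sub>k(j, V)\<close> over \<open>j \<le> 2L\<close>
  \<open>\<lambda>\<^sub>k(L, V) = (m\<^sub>k(L, V) - m\<^bsub>k+1\<^esub>(L, V)) / m\<^sub>1(L, V)\<close> (lemma \<open>cluster_prob_eq\<close>).

  Taking \<open>V = U n\<close>, it remains to let \<open>n\<close> and then \<open>L\<close> tend to infinity. For small \<open>j\<close> nothing is
  known about convergence of \<open>\<alpha>\<^sub>k(j, U n)\<close> in \<open>n\<close>, but these boundedly many terms, each of size at
  most 1, disappear from a Cesaro mean as \<open>L\<close> grows (lemma \<open>iterated_cesaro\<close>), so that
  \<open>m\<^sub>k(L, U n)\<close> tends to \<open>\<alpha>\<^sub>k\<close>.

  Summability makes the limits of \<open>hat_alpha\<close> tend to 0 as \<open>l\<close> grows, and this forces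
  \<open>\<alpha>\<^sub>1 > 0\<close> (lemma \<open>alpha_1_pos\<close>). Indeed, since
  \<open>\<mu>(Z = k) \<ge> 0\<close>, the means \<open>m\<^sub>k\<close> and hence the limits \<open>\<alpha>\<^sub>k\<close> decrease in \<open>k\<close>. If
  \<open>\<alpha>\<^sub>1 \<le> 0\<close>, then all increments of the limits of \<open>hat_alpha\<close> in \<open>l\<close> are nonnegative, so these
  limits never fall below their first value 1 and cannot tend to 0.\<close>

section \<open>Counting hits\<close>

definition hits :: "('a \<Rightarrow> 'a) \<Rightarrow> 'a set \<Rightarrow> nat \<Rightarrow> 'a \<Rightarrow> nat" where
  "hits T U n x = (\<Sum>i<n. indicator U ((T ^^ i) x))"

lemma hits_0 [simp]: "hits T U 0 x = 0"
  by (simp add: hits_def)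

lemma hits_Suc: "hits T U (Suc n) x = indicator U x + hits T U n (T x)"
  unfolding hits_def by (subst sum.lessThan_Suc_shift) (simp add: funpow_swap1)

lemma hits_add: "hits T U (m + n) x = hits T U m x + hits T U n ((T ^^ m) x)"
  by (induction m arbitrary: x) (simp_all add: hits_Suc funpow_swap1)

lemma hits_mono: "m \<le> n \<Longrightarrow> hits T U m x \<le> hits T U n x"
  using hits_add[of T U m "n - m" x] by simp

lemma hits_pos_iff: "0 < hits T U n x \<longleftrightarrow> (\<exists>i<n. (T ^^ i) x \<in> U)"
  by (auto simp: hits_def indicator_eq_0_iff simp flip: neq0_conv)

lemma visits_eq_hits: "visits T U L x = hits T U (Suc (2 * L)) x"
  unfolding visits_def hits_def by (simp only: atLeast0AtMost lessThan_Suc_atMost)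

text \<open>The argument \<open>T x\<close> on the right shifts the counted times from \<open>0, \<dots>, n - 1\<close> to
  \<open>1, \<dots>, n\<close>, which are the times that count as returns.\<close>

lemma return_time_le_iff: "return_time T U x \<le> enat n \<longleftrightarrow> 0 < hits T U n (T x)"
proof -
  have "return_time T U x \<le> enat n \<longleftrightarrow> return_time T U x < enat (Suc n)"
    by (cases "return_time T U x") auto
  also have "\<dots> \<longleftrightarrow> (\<exists>j. 1 \<le> j \<and> (T ^^ j) x \<in> U \<and> j < Suc n)"
    unfolding return_time_def INF_less_iff by auto
  also have "\<dots> \<longleftrightarrow> (\<exists>i<n. (T ^^ Suc i) x \<in> U)"
    by (metis One_nat_def Suc_le_D Suc_less_eq le_add1 plus_1_eq_Suc)
  finally show ?thesis
    by (simp add: hits_pos_iff funpow_swap1)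
qed

lemma hits_return_time:
  assumes "return_time T U x = enat n"
  shows "hits T U n (T x) = 1"
proof (cases n)
  case 0
  then show ?thesis
    using assms return_time_le_iff[of T U x 0] by simp
next
  case (Suc m)
  have "hits T U m (T x) = 0"
    using assms Suc return_time_le_iff[of T U x m] by simp
  moreover have "0 < hits T U n (T x)"
    using assms return_time_le_iff[of T U x n] by simp
  ultimately show ?thesis
    using Suc hits_add[of T U m "Suc 0" "T x"] hits_Suc[of T U 0 "(T ^^ m) (T x)"]
    by (simp add: indicator_def split: if_splits)
qed

lemma hits_nth_return_time:
  assumes "nth_return_time T U l x = enat m"
  shows "hits T U m (T x) = l"
  using assms
proof (induction l arbitrary: m)
  case 0
  then show ?case by (simp add: zero_enat_def)
next
  case (Suc l)
  then obtain p where p: "nth_return_time T U l x = enat p"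
    by (cases "nth_return_time T U l x") auto
  with Suc.prems obtain r where r: "return_time T U ((T ^^ p) x) = enat r" and m: "m = p + r"
    by (cases "return_time T U ((T ^^ p) x)") auto
  show ?case
    using Suc.IH[OF p] hits_return_time[OF r] hits_add[of T U p r "T x"] m
    by (simp add: funpow_swap1)
qed

text \<open>This translates the recursively defined return times into hit counts. From right to left, the
  \<open>l\<close>-th return at time \<open>m \<le> n\<close> uses up only \<open>l\<close> of the at least \<open>l + 1\<close> hits, so one is left
  in \<open>(m, n]\<close>, and the next return occurs no later than it.\<close>

lemma nth_return_time_le_iff:
  "nth_return_time T U l x \<le> enat n \<longleftrightarrow> l \<le> hits T U n (T x)"
proof
  assume "nth_return_time T U l x \<le> enat n"
  then obtain m where "nth_return_time T U l x = enat m" "m \<le> n"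
    by (cases "nth_return_time T U l x") auto
  then show "l \<le> hits T U n (T x)"
    using hits_nth_return_time hits_mono by metis
next
  assume "l \<le> hits T U n (T x)"
  then show "nth_return_time T U l x \<le> enat n"
  proof (induction l)
    case 0
    then show ?case by (simp add: zero_enat_def)
  next
    case (Suc l)
    then have "nth_return_time T U l x \<le> enat n" by simp
    then obtain m where m: "nth_return_time T U l x = enat m" "m \<le> n"
      by (cases "nth_return_time T U l x") auto
    have "0 < hits T U (n - m) (T ((T ^^ m) x))"
      using hits_nth_return_time[OF m(1)] Suc.prems m(2) hits_add[of T U m "n - m" "T x"]
      by (simp add: funpow_swap1)
    then have "return_time T U ((T ^^ m) x) \<le> enat (n - m)"
      by (simp add: return_time_le_iff)
    then show ?case
      using m by (cases "return_time T U ((T ^^ m) x)") auto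
  qed
qed

section \<open>Hit counts under an invariant measure\<close>

locale invariant_prob = prob_space M for M :: "'a measure" +
  fixes T :: "'a \<Rightarrow> 'a"
  assumes T_measurable [measurable]: "T \<in> measurable M M"
    and distr_T: "distr M M T = M"
begin

lemma borel_measurable_hits [measurable]:
  assumes [measurable]: "U \<in> sets M"
  shows "hits T U n \<in> borel_measurable M"
proof -
  have "(\<lambda>x. indicator U ((T ^^ i) x) :: nat) \<in> borel_measurable M" for i
    by (rule measurable_compose[OF measurable_compose_n[OF T_measurable]
      borel_measurable_indicator[OF assms]])
  then show ?thesis
    unfolding hits_def[abs_def] by (rule borel_measurable_sum)
qed

lemma prob_T_invariant:
  assumes "{x \<in> space M. P x} \<in> events"
  shows "prob {x \<in> space M. P (T x)} = prob {x \<in> space M. P x}"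
proof -
  have "prob {x \<in> space M. P x} = measure (distr M M T) {x \<in> space M. P x}"
    by (simp add: distr_T)
  also have "\<dots> = prob (T -` {x \<in> space M. P x} \<inter> space M)"
    using assms by (intro measure_distr) auto
  also have "T -` {x \<in> space M. P x} \<inter> space M = {x \<in> space M. P (T x)}"
    using measurable_space[OF T_measurable] by auto
  finally show ?thesis by simp
qed

text \<open>The decomposition according to the \<open>k\<close>-th visit from the last, obtained by extending the window
  by one step at its beginning: the count of the longer window reaches \<open>k + 1\<close> either already
  without time 0, which has the same probability as for the shorter window by invariance, or only
  through a visit at time 0 that is followed by exactly \<open>k\<close> visits.\<close>

lemma prob_hits_ge:
  assumes [measurable]: "U \<in> sets M"
  shows "prob {x \<in> space M. Suc k \<le> hits T U n x} =
    (\<Sum>j<n. prob {x \<in> space M. x \<in> U \<and> hits T U j (T x) = k})"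
proof (induction n)
  case 0
  then show ?case by simp
next
  case (Suc n)
  have "{x \<in> space M. Suc k \<le> hits T U (Suc n) x} =
      {x \<in> space M. Suc k \<le> hits T U n (T x)} \<union>
      {x \<in> space M. x \<in> U \<and> hits T U n (T x) = k}"
    by (auto simp: hits_Suc indicator_def)
  then have "prob {x \<in> space M. Suc k \<le> hits T U (Suc n) x} =
      prob {x \<in> space M. Suc k \<le> hits T U n (T x)} +
      prob {x \<in> space M. x \<in> U \<and> hits T U n (T x) = k}"
    by (simp only:) (rule finite_measure_Union, measurable, auto)
  moreover have "prob {x \<in> space M. Suc k \<le> hits T U n (T x)} =
      prob {x \<in> space M. Suc k \<le> hits T U n x}"
    by (rule prob_T_invariant) measurable
  ultimately show ?case
    using Suc by simp
qed

definition exact_return_prob :: "nat \<Rightarrow> nat \<Rightarrow> 'a set \<Rightarrow> real" where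
  "exact_return_prob k L U = hat_alpha M T k L U - hat_alpha M T (Suc k) L U"

lemma hat_alpha_eq:
  assumes [measurable]: "U \<in> sets M" and "0 < prob U"
  shows "hat_alpha M T l L U =
    prob {x \<in> space M. x \<in> U \<and> l - 1 \<le> hits T U L (T x)} / prob U"
proof -
  have "hat_alpha M T l L U =
      prob (U \<inter> {x \<in> space M. l - 1 \<le> hits T U L (T x)}) / prob U"
    unfolding hat_alpha_def nth_return_time_le_iff using assms
    by (subst measure_uniform_measure) (auto simp: emeasure_eq_measure)
  also have "U \<inter> {x \<in> space M. l - 1 \<le> hits T U L (T x)} =
      {x \<in> space M. x \<in> U \<and> l - 1 \<le> hits T U L (T x)}"
    by auto
  finally show ?thesis .
qed

lemma exact_return_prob_eq:
  assumes [measurable]: "U \<in> sets M" and "0 < prob U"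
  shows "exact_return_prob (Suc k) L U =
    prob {x \<in> space M. x \<in> U \<and> hits T U L (T x) = k} / prob U"
proof -
  have "{x \<in> space M. x \<in> U \<and> k \<le> hits T U L (T x)} =
      {x \<in> space M. x \<in> U \<and> Suc k \<le> hits T U L (T x)} \<union>
      {x \<in> space M. x \<in> U \<and> hits T U L (T x) = k}"
    by auto
  then have "prob {x \<in> space M. x \<in> U \<and> k \<le> hits T U L (T x)} =
      prob {x \<in> space M. x \<in> U \<and> Suc k \<le> hits T U L (T x)} +
      prob {x \<in> space M. x \<in> U \<and> hits T U L (T x) = k}"
    by (simp only:) (rule finite_measure_Union, measurable, auto)
  then show ?thesis
    using assms by (simp add: exact_return_prob_def hat_alpha_eq divide_simps)
qed

lemma hat_alpha_bounds:
  assumes [measurable]: "U \<in> sets M" and "0 < prob U"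
  shows "0 \<le> hat_alpha M T l L U" "hat_alpha M T l L U \<le> 1"
proof -
  show "0 \<le> hat_alpha M T l L U"
    by (simp add: hat_alpha_def)
  have "prob {x \<in> space M. x \<in> U \<and> l - 1 \<le> hits T U L (T x)} \<le> prob U"
    by (rule finite_measure_mono) auto
  then show "hat_alpha M T l L U \<le> 1"
    using assms by (simp add: hat_alpha_eq divide_simps)
qed

lemma hat_alpha_mono:
  assumes [measurable]: "U \<in> sets M" and "0 < prob U" and "L \<le> L'"
  shows "hat_alpha M T l L U \<le> hat_alpha M T l L' U"
proof -
  have "prob {x \<in> space M. x \<in> U \<and> l - 1 \<le> hits T U L (T x)} \<le>
      prob {x \<in> space M. x \<in> U \<and> l - 1 \<le> hits T U L' (T x)}"
    using hits_mono[OF \<open>L \<le> L'\<close>, of T U] by (intro finite_measure_mono) (auto intro: order_trans)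
  then show ?thesis
    using assms by (simp add: hat_alpha_eq divide_right_mono)
qed

lemma hat_alpha_1:
  assumes "U \<in> sets M" and "0 < prob U"
  shows "hat_alpha M T (Suc 0) L U = 1"
proof -
  have "{x \<in> space M. x \<in> U} = U"
    using sets.sets_into_space[OF assms(1)] by auto
  then show ?thesis
    using assms by (simp add: hat_alpha_eq)
qed

definition mean_return_prob :: "nat \<Rightarrow> nat \<Rightarrow> 'a set \<Rightarrow> real" where
  "mean_return_prob k L U = (\<Sum>j\<le>2 * L. exact_return_prob k j U) / real (Suc (2 * L))"

lemma prob_visits_ge:
  assumes "U \<in> sets M" and "0 < prob U" and "1 \<le> k"
  shows "prob {x \<in> space M. k \<le> visits T U L x} =
    real (Suc (2 * L)) * prob U * mean_return_prob k L U"
proof -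
  obtain k' where k: "k = Suc k'"
    using assms(3) by (cases k) auto
  have "prob {x \<in> space M. k \<le> visits T U L x} =
      (\<Sum>j\<le>2 * L. prob {x \<in> space M. x \<in> U \<and> hits T U j (T x) = k'})"
    using prob_hits_ge[OF assms(1), of k' "Suc (2 * L)"]
    by (simp only: visits_eq_hits k lessThan_Suc_atMost)
  also have "\<dots> = (\<Sum>j\<le>2 * L. prob U * exact_return_prob k j U)"
    using assms k by (intro sum.cong) (simp_all add: exact_return_prob_eq)
  finally show ?thesis
    unfolding mean_return_prob_def sum_distrib_left[symmetric]
    by (simp del: of_nat_Suc sum.atMost_Suc)
qed

lemma prob_visits_eq:
  assumes [measurable]: "U \<in> sets M" and "0 < prob U" and "1 \<le> k"
  shows "prob {x \<in> space M. visits T U L x = k} =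
    real (Suc (2 * L)) * prob U * (mean_return_prob k L U - mean_return_prob (Suc k) L U)"
proof -
  have [measurable]: "visits T U L \<in> borel_measurable M"
    unfolding visits_eq_hits[abs_def] by measurable
  have "{x \<in> space M. k \<le> visits T U L x} =
      {x \<in> space M. Suc k \<le> visits T U L x} \<union> {x \<in> space M. visits T U L x = k}"
    by auto
  then have "prob {x \<in> space M. k \<le> visits T U L x} =
      prob {x \<in> space M. Suc k \<le> visits T U L x} + prob {x \<in> space M. visits T U L x = k}"
    by (simp only:) (rule finite_measure_Union, measurable, auto)
  then show ?thesis
    using assms by (simp add: prob_visits_ge algebra_simps)
qed

lemma cluster_prob_eq:
  assumes "U \<in> sets M" and "0 < prob U" and "1 \<le> k"
  shows "cluster_prob M T k L U =
    (mean_return_prob k L U - mean_return_prob (Suc k) L U) / mean_return_prob 1 L U"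
proof -
  have "prob {x \<in> space M. 0 < visits T U L x} = real (Suc (2 * L)) * prob U * mean_return_prob 1 L U"
    using prob_visits_ge[OF assms(1,2), of 1 L] by (simp add: Suc_le_eq)
  then show ?thesis
    unfolding cluster_prob_def prob_visits_eq[OF assms] using assms(2) by simp
qed

text \<open>The difference is, up to a positive factor, the probability of exactly \<open>k\<close> visits.\<close>

lemma mean_return_prob_antimono:
  assumes "U \<in> sets M" and "0 < prob U" and "1 \<le> k"
  shows "mean_return_prob (Suc k) L U \<le> mean_return_prob k L U"
proof -
  have "0 \<le> (real (Suc (2 * L)) * prob U) * (mean_return_prob k L U - mean_return_prob (Suc k) L U)"
    unfolding prob_visits_eq[OF assms, symmetric] by simp
  moreover have "0 < real (Suc (2 * L)) * prob U"
    using assms(2) by simp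
  ultimately show ?thesis
    by (simp add: zero_le_mult_iff)
qed

text \<open>A point of \<open>U\<close> has no return within time 0, so the term \<open>j = 0\<close> of the mean is 1. This
  keeps the denominator of the cluster probability away from 0 at fixed \<open>L\<close>, uniformly in the
  target.\<close>

lemma mean_return_prob_1_ge:
  assumes "U \<in> sets M" and "0 < prob U"
  shows "1 / real (Suc (2 * L)) \<le> mean_return_prob 1 L U"
proof -
  have "{x \<in> space M. x \<in> U} = U"
    using sets.sets_into_space[OF assms(1)] by auto
  then have "exact_return_prob 1 0 U = 1"
    using exact_return_prob_eq[OF assms, of 0 0] assms(2) by simp
  moreover have "exact_return_prob 1 0 U \<le> (\<Sum>j\<le>2 * L. exact_return_prob 1 j U)"
    using assms exact_return_prob_eq[OF assms, of 0] by (intro member_le_sum) auto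
  ultimately show ?thesis
    unfolding mean_return_prob_def by (intro divide_right_mono) auto
qed

end

section \<open>Iterated limits\<close>

text \<open>The filter for letting first \<open>n\<close> and then \<open>L\<close> tend to infinity. Convergence along it does not
  ask for a limit in \<open>n\<close> at fixed \<open>L\<close>, and yet the general limit laws apply to it.\<close>

definition iterated_filter :: "(nat \<times> nat) filter" where
  "iterated_filter = Abs_filter (\<lambda>P. \<forall>\<^sub>F L in sequentially. \<forall>\<^sub>F n in sequentially. P (L, n))"

lemma eventually_iterated_filter:
  "eventually P iterated_filter \<longleftrightarrow>
    (\<forall>\<^sub>F L in sequentially. \<forall>\<^sub>F n in sequentially. P (L, n))"
  unfolding iterated_filter_def
proof (rule eventually_Abs_filter, rule is_filter.intro)
  fix P Q :: "nat \<times> nat \<Rightarrow> bool"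
  assume "\<forall>\<^sub>F L in sequentially. \<forall>\<^sub>F n in sequentially. P (L, n)"
    and "\<forall>\<^sub>F L in sequentially. \<forall>\<^sub>F n in sequentially. Q (L, n)"
  then show "\<forall>\<^sub>F L in sequentially. \<forall>\<^sub>F n in sequentially. P (L, n) \<and> Q (L, n)"
    by eventually_elim (rule eventually_conj)
next
  fix P Q :: "nat \<times> nat \<Rightarrow> bool"
  assume PQ: "\<forall>x. P x \<longrightarrow> Q x"
    and "\<forall>\<^sub>F L in sequentially. \<forall>\<^sub>F n in sequentially. P (L, n)"
  from this(2) show "\<forall>\<^sub>F L in sequentially. \<forall>\<^sub>F n in sequentially. Q (L, n)"
    by eventually_elim (use PQ in \<open>auto elim: eventually_mono\<close>)
qed simp

lemma iterated_filter_neq_bot [simp]: "iterated_filter \<noteq> bot"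
  by (simp add: trivial_limit_def eventually_iterated_filter)

lemma tendsto_iterated:
  fixes f :: "nat \<Rightarrow> nat \<Rightarrow> 'b :: topological_space"
  assumes "\<forall>\<^sub>F L in sequentially. f L \<longlonglongrightarrow> g L" and "g \<longlonglongrightarrow> c"
  shows "((\<lambda>(L, n). f L n) \<longlongrightarrow> c) iterated_filter"
proof (rule topological_tendstoI)
  fix S assume S: "open S" "c \<in> S"
  have "\<forall>\<^sub>F L in sequentially. g L \<in> S"
    using assms(2) S by (rule topological_tendstoD)
  with assms(1) have "\<forall>\<^sub>F L in sequentially. \<forall>\<^sub>F n in sequentially. f L n \<in> S"
    by eventually_elim (use S in \<open>auto dest: topological_tendstoD\<close>)
  then show "\<forall>\<^sub>F p in iterated_filter. (case p of (L, n) \<Rightarrow> f L n) \<in> S"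
    by (simp add: eventually_iterated_filter)
qed

text \<open>Fix \<open>J\<close> such that the terms with index at least \<open>J\<close> are eventually close to \<open>c\<close>. For given
  \<open>L\<close>, only finitely many such terms occur in the mean, so they are close to \<open>c\<close> simultaneously for
  large \<open>n\<close>. The first \<open>J\<close> terms contribute at most a constant divided by the length of the mean.\<close>

lemma iterated_cesaro:
  fixes f :: "nat \<Rightarrow> nat \<Rightarrow> real"
  assumes lim: "((\<lambda>(j, n). f j n) \<longlongrightarrow> c) iterated_filter"
    and bounded: "\<And>j n. \<bar>f j n\<bar> \<le> B"
  shows "((\<lambda>(L, n). (\<Sum>j\<le>2 * L. f j n) / real (Suc (2 * L))) \<longlongrightarrow> c) iterated_filter"
proof (rule tendstoI)
  fix e :: real assume e: "0 < e"
  have "\<forall>\<^sub>F j in sequentially. \<forall>\<^sub>F n in sequentially. \<bar>f j n - c\<bar> < e / 2"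
    using tendstoD[OF lim, of "e / 2"] e by (simp add: eventually_iterated_filter dist_real_def)
  then obtain J where J: "\<And>j. J \<le> j \<Longrightarrow> \<forall>\<^sub>F n in sequentially. \<bar>f j n - c\<bar> < e / 2"
    by (auto simp: eventually_sequentially)
  define C where "C = real J * (B + \<bar>c\<bar>)"
  have "(\<lambda>L. C / real (Suc (2 * L))) \<longlonglongrightarrow> 0"
    by real_asymp
  then have "\<forall>\<^sub>F L in sequentially. C / real (Suc (2 * L)) < e / 2"
    using e by (intro order_tendstoD(2)[of _ 0]) auto
  then have "\<forall>\<^sub>F L in sequentially. \<forall>\<^sub>F n in sequentially.
      \<bar>(\<Sum>j\<le>2 * L. f j n) / real (Suc (2 * L)) - c\<bar> < e"
  proof eventually_elim
    case (elim L)
    have "\<forall>\<^sub>F n in sequentially. \<forall>j\<in>{J..2 * L}. \<bar>f j n - c\<bar> < e / 2"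
      by (intro eventually_ball_finite ballI J) auto
    then show ?case
    proof eventually_elim
      case (elim n)
      have "\<bar>(\<Sum>j\<le>2 * L. f j n) - real (Suc (2 * L)) * c\<bar> = \<bar>\<Sum>j\<le>2 * L. f j n - c\<bar>"
        by (simp add: sum_subtractf)
      also have "\<dots> \<le> (\<Sum>j\<le>2 * L. \<bar>f j n - c\<bar>)"
        by (rule sum_abs)
      also have "\<dots> \<le> (\<Sum>j\<le>2 * L. (if j < J then B + \<bar>c\<bar> else 0) + e / 2)"
      proof (rule sum_mono)
        fix j assume "j \<in> {..2 * L}"
        then show "\<bar>f j n - c\<bar> \<le> (if j < J then B + \<bar>c\<bar> else 0) + e / 2"
          using elim[THEN bspec, of j] bounded[of j n] e by (auto simp: abs_if split: if_splits)
      qed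
      also have "\<dots> = (\<Sum>j\<in>{..2 * L} \<inter> {..<J}. B + \<bar>c\<bar>) + real (Suc (2 * L)) * (e / 2)"
        by (simp add: sum.distrib sum.If_cases lessThan_def)
      also have "(\<Sum>j\<in>{..2 * L} \<inter> {..<J}. B + \<bar>c\<bar>) \<le> (\<Sum>j\<in>{..<J}. B + \<bar>c\<bar>)"
        using bounded[of 0 0] by (intro sum_mono2) auto
      finally have *: "\<bar>(\<Sum>j\<le>2 * L. f j n) - real (Suc (2 * L)) * c\<bar> \<le> C + real (Suc (2 * L)) * (e / 2)"
        by (simp add: C_def)
      have "(\<Sum>j\<le>2 * L. f j n) / real (Suc (2 * L)) - c =
          ((\<Sum>j\<le>2 * L. f j n) - real (Suc (2 * L)) * c) / real (Suc (2 * L))"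
        by (simp add: field_simps)
      then have "\<bar>(\<Sum>j\<le>2 * L. f j n) / real (Suc (2 * L)) - c\<bar> =
          \<bar>(\<Sum>j\<le>2 * L. f j n) - real (Suc (2 * L)) * c\<bar> / real (Suc (2 * L))"
        by (simp only: abs_divide abs_of_nat)
      also have "\<dots> \<le> (C + real (Suc (2 * L)) * (e / 2)) / real (Suc (2 * L))"
        using * by (rule divide_right_mono) simp
      also have "\<dots> = C / real (Suc (2 * L)) + e / 2"
        by (simp add: add_divide_distrib del: of_nat_Suc)
      finally show ?case
        using \<open>C / real (Suc (2 * L)) < e / 2\<close> by linarith
    qed
  qed
  then show "\<forall>\<^sub>F p in iterated_filter.
      dist (case p of (L, n) \<Rightarrow> (\<Sum>j\<le>2 * L. f j n) / real (Suc (2 * L))) c < e"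
    by (simp add: eventually_iterated_filter dist_real_def)
qed

text \<open>If \<open>f L\<close> is eventually on one side of \<open>b\<close>, then so are its upper and lower limits, up to
  equality. The number \<open>b\<close> strictly between \<open>a\<close> and \<open>c\<close> absorbs this loss of strictness.\<close>

lemma iterated_tendsto_Limsup_Liminf:
  fixes f :: "nat \<Rightarrow> nat \<Rightarrow> real"
  assumes "((\<lambda>(L, n). f L n) \<longlongrightarrow> c) iterated_filter"
  shows "(\<lambda>L. limsup (\<lambda>n. ereal (f L n))) \<longlonglongrightarrow> ereal c"
    and "(\<lambda>L. liminf (\<lambda>n. ereal (f L n))) \<longlonglongrightarrow> ereal c"
proof -
  have squeeze: "(\<lambda>L. h L) \<longlonglongrightarrow> ereal c"
    if h: "\<And>L. liminf (\<lambda>n. ereal (f L n)) \<le> h L" "\<And>L. h L \<le> limsup (\<lambda>n. ereal (f L n))"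
    for h :: "nat \<Rightarrow> ereal"
  proof (rule order_tendstoI)
    fix a :: ereal assume "a < ereal c"
    then obtain b where b: "a < ereal b" "ereal b < ereal c"
      using ereal_dense2 by blast
    have "\<forall>\<^sub>F L in sequentially. \<forall>\<^sub>F n in sequentially. b < f L n"
      using order_tendstoD(1)[OF assms, of b] b by (simp add: eventually_iterated_filter)
    then show "\<forall>\<^sub>F L in sequentially. a < h L"
    proof eventually_elim
      case (elim L)
      have "ereal b \<le> liminf (\<lambda>n. ereal (f L n))"
        by (rule Liminf_bounded) (use elim in \<open>auto elim: eventually_mono\<close>)
      then show ?case
        using b(1) h(1)[of L] by (meson less_le_trans)
    qed
  next
    fix a :: ereal assume "ereal c < a"
    then obtain b where b: "ereal b < a" "ereal c < ereal b"
      using ereal_dense2 by blast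
    have "\<forall>\<^sub>F L in sequentially. \<forall>\<^sub>F n in sequentially. f L n < b"
      using order_tendstoD(2)[OF assms, of b] b by (simp add: eventually_iterated_filter)
    then show "\<forall>\<^sub>F L in sequentially. h L < a"
    proof eventually_elim
      case (elim L)
      have "limsup (\<lambda>n. ereal (f L n)) \<le> ereal b"
        by (rule Limsup_bounded) (use elim in \<open>auto elim: eventually_mono\<close>)
      then show ?case
        using b(1) h(2)[of L] by (meson le_less_trans)
    qed
  qed
  have "liminf (\<lambda>n. ereal (f L n)) \<le> limsup (\<lambda>n. ereal (f L n))" for L
    by (rule Liminf_le_Limsup) simp
  then show "(\<lambda>L. limsup (\<lambda>n. ereal (f L n))) \<longlonglongrightarrow> ereal c"
    and "(\<lambda>L. liminf (\<lambda>n. ereal (f L n))) \<longlonglongrightarrow> ereal c"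
    by (auto intro!: squeeze)
qed

lemma iterated_tendsto_lim:
  fixes f :: "nat \<Rightarrow> nat \<Rightarrow> real"
  assumes "((\<lambda>(L, n). f L n) \<longlongrightarrow> c) iterated_filter"
    and "\<forall>\<^sub>F L in sequentially. convergent (f L)"
  shows "(\<lambda>L. lim (f L)) \<longlonglongrightarrow> c"
proof -
  have "\<forall>\<^sub>F L in sequentially. limsup (\<lambda>n. ereal (f L n)) = ereal (lim (f L))"
    using assms(2)
    by eventually_elim (intro lim_imp_Limsup, auto simp: convergent_LIMSEQ_iff)
  then have "(\<lambda>L. ereal (lim (f L))) \<longlonglongrightarrow> ereal c"
    using iterated_tendsto_Limsup_Liminf(1)[OF assms(1)] by (simp add: tendsto_cong)
  then show ?thesis by simp
qed

section \<open>The limiting cluster size distribution\<close>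

locale return_limits = invariant_prob M T for M :: "'a measure" and T +
  fixes U :: "nat \<Rightarrow> 'a set"
  assumes U_sets: "\<And>n. U n \<in> sets M"
    and U_pos: "\<And>n. 0 < prob (U n)"
    and hat_alpha_convergent:
      "\<And>l. 1 \<le> l \<Longrightarrow> \<forall>\<^sub>F L in sequentially. convergent (\<lambda>n. hat_alpha M T l L (U n))"
begin

lemma hat_alpha_L_tendsto:
  assumes "1 \<le> l"
  shows "\<forall>\<^sub>F L in sequentially. (\<lambda>n. hat_alpha M T l L (U n)) \<longlonglongrightarrow> hat_alpha_L M T U l L"
  using hat_alpha_convergent[OF assms]
  by eventually_elim (simp add: hat_alpha_L_def convergent_LIMSEQ_iff)

text \<open>The probabilities increase with \<open>L\<close> and are at most 1. Their limits in \<open>n\<close> inherit this only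
  from some \<open>J\<close> on, where they are known to exist, so the sequence is shifted by \<open>J\<close>.\<close>

lemma hat_alpha_lim_tendsto:
  assumes "1 \<le> l"
  shows "hat_alpha_L M T U l \<longlonglongrightarrow> hat_alpha_lim M T U l"
proof -
  obtain J where J: "\<And>L. J \<le> L \<Longrightarrow> (\<lambda>n. hat_alpha M T l L (U n)) \<longlonglongrightarrow> hat_alpha_L M T U l L"
    using hat_alpha_L_tendsto[OF assms] by (auto simp: eventually_sequentially)
  have "incseq (\<lambda>L. hat_alpha_L M T U l (L + J))"
    by (intro incseq_SucI LIMSEQ_le[OF J J])
      (auto intro!: exI[of _ 0] hat_alpha_mono U_sets U_pos)
  moreover have "hat_alpha_L M T U l (L + J) \<le> 1" for L
    by (rule LIMSEQ_le_const2[OF J]) (auto intro!: exI[of _ 0] hat_alpha_bounds U_sets U_pos)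
  ultimately obtain c where "(\<lambda>L. hat_alpha_L M T U l (L + J)) \<longlonglongrightarrow> c"
    by (metis incseq_convergent)
  then have "hat_alpha_L M T U l \<longlonglongrightarrow> c"
    by (rule LIMSEQ_offset)
  then show ?thesis
    by (simp add: hat_alpha_lim_def limI)
qed

lemma hat_alpha_lim_1: "hat_alpha_lim M T U (Suc 0) = 1"
proof -
  have "hat_alpha_L M T U (Suc 0) = (\<lambda>L. 1)"
    by (rule ext) (simp add: hat_alpha_L_def hat_alpha_1[OF U_sets U_pos] limI)
  then show ?thesis
    by (simp add: hat_alpha_lim_def limI)
qed

lemma mean_return_prob_tendsto:
  assumes "1 \<le> k"
  shows "((\<lambda>(L, n). mean_return_prob k L (U n)) \<longlongrightarrow> alpha M T U k) iterated_filter"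
proof -
  have hat: "((\<lambda>(L, n). hat_alpha M T l L (U n)) \<longlongrightarrow> hat_alpha_lim M T U l) iterated_filter"
    if "1 \<le> l" for l
    using that by (intro tendsto_iterated[OF hat_alpha_L_tendsto hat_alpha_lim_tendsto])
  have "((\<lambda>(L, n). exact_return_prob k L (U n)) \<longlongrightarrow> alpha M T U k) iterated_filter"
    using tendsto_diff[OF hat hat, of k "Suc k"] assms
    by (simp add: exact_return_prob_def alpha_def case_prod_unfold)
  moreover have "\<bar>exact_return_prob k j (U n)\<bar> \<le> 1" for j n
    using hat_alpha_bounds[OF U_sets U_pos, of k j n] hat_alpha_bounds[OF U_sets U_pos, of "Suc k" j n]
    unfolding exact_return_prob_def by linarith
  ultimately show ?thesis
    unfolding mean_return_prob_def by (rule iterated_cesaro)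
qed

lemma alpha_antimono:
  assumes "1 \<le> k"
  shows "alpha M T U (Suc k) \<le> alpha M T U k"
proof (rule tendsto_le[OF _ mean_return_prob_tendsto mean_return_prob_tendsto])
  show "\<forall>\<^sub>F p in iterated_filter. (case p of (L, n) \<Rightarrow> mean_return_prob (Suc k) L (U n))
      \<le> (case p of (L, n) \<Rightarrow> mean_return_prob k L (U n))"
    using assms by (intro always_eventually) (auto intro: mean_return_prob_antimono U_sets U_pos)
qed (use assms in auto)

text \<open>The consecutive differences \<open>\<alpha>\<^sub>k\<close> of the limits are decreasing in \<open>k\<close>. If the first were not
  positive, no later one would be, and the limits could not descend from their first value 1 to 0.\<close>

lemma alpha_1_pos:
  assumes "(hat_alpha_lim M T U) \<longlonglongrightarrow> 0"
  shows "0 < alpha M T U 1"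
proof (rule ccontr)
  assume "\<not> 0 < alpha M T U 1"
  then have nonpos: "alpha M T U (Suc k) \<le> 0" for k
  proof (induction k)
    case (Suc k)
    then show ?case using alpha_antimono[of "Suc k"] by simp
  qed simp
  have "1 \<le> hat_alpha_lim M T U (Suc k)" for k
  proof (induction k)
    case 0
    then show ?case by (simp add: hat_alpha_lim_1)
  next
    case (Suc k)
    then show ?case using nonpos[of k] by (simp add: alpha_def)
  qed
  then have "1 \<le> (0 :: real)"
    using LIMSEQ_Suc[OF assms] by (intro LIMSEQ_le_const[of _ 0 1]) auto
  then show False by simp
qed

lemma cluster_prob_tendsto:
  assumes "1 \<le> k" and "alpha M T U 1 \<noteq> 0"
  shows "((\<lambda>(L, n). cluster_prob M T k L (U n)) \<longlongrightarrow>
    (alpha M T U k - alpha M T U (k + 1)) / alpha M T U 1) iterated_filter"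
  using tendsto_divide[OF tendsto_diff[OF mean_return_prob_tendsto[of k]
    mean_return_prob_tendsto[of "Suc k"]] mean_return_prob_tendsto[of 1]] assms
  by (simp add: cluster_prob_eq[OF U_sets U_pos] case_prod_unfold)

text \<open>At fixed \<open>L\<close> the cluster probability is a rational function of finitely many values of
  \<open>hat_alpha\<close>, whose denominator is bounded below by \<open>mean_return_prob_1_ge\<close>.\<close>

lemma cluster_prob_convergent:
  assumes "1 \<le> k"
    and conv: "\<And>l j. 1 \<le> l \<Longrightarrow> j \<le> 2 * L \<Longrightarrow> convergent (\<lambda>n. hat_alpha M T l j (U n))"
  shows "convergent (\<lambda>n. cluster_prob M T k L (U n))"
proof -
  have mean: "\<exists>c. (\<lambda>n. mean_return_prob l L (U n)) \<longlonglongrightarrow> c" if "1 \<le> l" for l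
  proof -
    have "convergent (\<lambda>n. \<Sum>j\<le>2 * L. exact_return_prob l j (U n))"
      unfolding exact_return_prob_def
      by (intro convergent_sum convergent_diff conv) (use that in auto)
    then obtain c where "(\<lambda>n. \<Sum>j\<le>2 * L. exact_return_prob l j (U n)) \<longlonglongrightarrow> c"
      by (auto simp: convergent_def)
    from tendsto_divide[OF this tendsto_const, of "real (Suc (2 * L))"] show ?thesis
      unfolding mean_return_prob_def by auto
  qed
  obtain a b c where a: "(\<lambda>n. mean_return_prob k L (U n)) \<longlonglongrightarrow> a"
    and b: "(\<lambda>n. mean_return_prob (Suc k) L (U n)) \<longlonglongrightarrow> b"
    and c: "(\<lambda>n. mean_return_prob 1 L (U n)) \<longlonglongrightarrow> c"
    using mean[of k] mean[of "Suc k"] mean[of 1] assms(1) by auto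
  have "1 / real (Suc (2 * L)) \<le> c"
    by (rule LIMSEQ_le_const[OF c])
      (intro exI allI impI mean_return_prob_1_ge U_sets U_pos)
  moreover have "0 < 1 / real (Suc (2 * L))"
    by simp
  ultimately have "c \<noteq> 0"
    by linarith
  then have "(\<lambda>n. cluster_prob M T k L (U n)) \<longlonglongrightarrow> (a - b) / c"
    unfolding cluster_prob_eq[OF U_sets U_pos assms(1)]
    by (intro tendsto_divide tendsto_diff a b c)
  then show ?thesis
    by (auto simp: convergent_def)
qed

end

theorem theorem2:
  fixes M :: "'a measure" and T :: "'a \<Rightarrow> 'a" and U :: "nat \<Rightarrow> 'a set" and k :: nat
  assumes "prob_space M"
    and "T \<in> measurable M M"
    and "distr M M T = M"
    and "\<And>n. U n \<in> sets M"
    and "\<And>n. measure M (U n) > 0"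
    and "decseq U"
    and "(\<lambda>n. measure M (U n)) \<longlonglongrightarrow> 0"
    and "\<And>l. l \<ge> 1 \<Longrightarrow> \<forall>\<^sub>F L in sequentially. convergent (\<lambda>n. hat_alpha M T l L (U n))"
    and "summable (\<lambda>l. real l * hat_alpha_lim M T U l)"
    and "k \<ge> 1"
  defines "v \<equiv> (alpha M T U k - alpha M T U (k + 1)) / alpha M T U 1"
  shows "((\<lambda>L. limsup (\<lambda>n. ereal (cluster_prob M T k L (U n)))) \<longlonglongrightarrow> ereal v) \<and>
    ((\<lambda>L. liminf (\<lambda>n. ereal (cluster_prob M T k L (U n)))) \<longlonglongrightarrow> ereal v) \<and>
    ((\<forall>\<^sub>F L in sequentially. convergent (\<lambda>n. cluster_prob M T k L (U n))) \<longrightarrow>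
       (\<lambda>L. cluster_prob_L M T U k L) \<longlonglongrightarrow> v) \<and>
    (\<forall>L. (\<forall>l\<ge>1. \<forall>j\<le>2 * L. convergent (\<lambda>n. hat_alpha M T l j (U n))) \<longrightarrow>
       convergent (\<lambda>n. cluster_prob M T k L (U n)))"
proof -
  interpret prob_space M by fact
  interpret return_limits M T U
    by unfold_locales (use assms in auto)
  have "(\<lambda>l. real l * hat_alpha_lim M T U l) \<longlonglongrightarrow> 0"
    using assms(9) by (rule summable_LIMSEQ_zero)
  then have "(\<lambda>l. inverse (real l) * (real l * hat_alpha_lim M T U l)) \<longlonglongrightarrow> 0 * 0"
    by (intro tendsto_mult) real_asymp
  moreover have "\<forall>\<^sub>F l in sequentially.
      inverse (real l) * (real l * hat_alpha_lim M T U l) = hat_alpha_lim M T U l"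
    using eventually_gt_at_top[of 0] by eventually_elim simp
  ultimately have "hat_alpha_lim M T U \<longlonglongrightarrow> 0"
    by (simp add: tendsto_cong)
  then have "alpha M T U 1 \<noteq> 0"
    using alpha_1_pos by simp
  then have lim: "((\<lambda>(L, n). cluster_prob M T k L (U n)) \<longlongrightarrow> v) iterated_filter"
    unfolding v_def by (intro cluster_prob_tendsto \<open>k \<ge> 1\<close>)
  show ?thesis
    unfolding cluster_prob_L_def
    using iterated_tendsto_Limsup_Liminf[OF lim] iterated_tendsto_lim[OF lim]
      cluster_prob_convergent[OF \<open>k \<ge> 1\<close>] by blast
qed

end
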